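(* Let $0<r<1$, let $m\ge1$, and let $\zeta_1,\ldots,\zeta_m\in\mathbb{D}$ be defined by $$\zeta_k=r\exp\left(i\frac{2\pi}{m}(k-1)\right),\qquad k=1,\ldots,m.$$ Let $\mathcal{L}_\zeta:\mathcal{H}_2(\mathbb{D})\to\mathbb{C}^m$, $\mathcal{L}_\zeta(F)=(F(\zeta_1),\ldots,F(\zeta_m))$. Then, for any integer $1\le n\le m$, $$\mu_{\mathcal{H}_2}(\ker(\mathcal{L}_\zeta),\mathcal{P}_n)=\frac{1}{\sqrt{1-r^{2m}}}.$$
   Context: $\mathbb{D}$ is the open unit disk in $\mathbb{C}$. $\mathcal{H}_2(\mathbb{D})$ is the Hardy space of functions $F(z)=\sum_{n\ge0}f_nz^n$ analytic on $\mathbb{D}$ with $\|F\|_{\mathcal{H}_2}=(\sum_{n\ge0}|f_n|^2)^{1/2}<\infty$. $\mathcal{P}_n$ is the space of complex polynomials of degree at most $n-1$. For a subspace $\mathcal{V}$ of $\mathcal{H}_2(\mathbb{D})$, $$\mu_{\mathcal{H}_2}(\ker(\mathcal{L}_\zeta),\mathcal{V})=\sup_{F\in\ker(\mathcal{L}_\zeta),\,F\neq0}\frac{\|F\|_{\mathcal{H}_2}}{\mathrm{dist}_{\mathcal{H}_2}(F,\mathcal{V})},\qquad \mathrm{dist}_{\mathcal{H}_2}(F,\mathcal{V})=\inf_{V\in\mathcal{V}}\|F-V\|_{\mathcal{H}_2}.$$ *)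

theory Defs
  imports "HOL-Complex_Analysis.Complex_Analysis"
begin

text \<open>
  Functions on the open unit disk are represented by total functions on the complex plane whose
  values outside the disk are irrelevant: the coefficients, the norm and the distance below
  depend only on the values on the disk, and ``\<open>F \<noteq> 0\<close>'' is read as ``not identically zero on the disk''.
\<close>

definition hardy_coeff :: "(complex \<Rightarrow> complex) \<Rightarrow> nat \<Rightarrow> complex" where
  "hardy_coeff F n = fps_nth (fps_expansion F 0) n"

definition hardy2 :: "(complex \<Rightarrow> complex) set" where
  "hardy2 = {F. F holomorphic_on ball 0 1 \<and> summable (\<lambda>n. (cmod (hardy_coeff F n))\<^sup>2)}"

definition hardy_norm :: "(complex \<Rightarrow> complex) \<Rightarrow> real" where
  "hardy_norm F = sqrt (\<Sum>n. (cmod (hardy_coeff F n))\<^sup>2)"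

definition hardy_dist :: "(complex \<Rightarrow> complex) \<Rightarrow> (complex \<Rightarrow> complex) set \<Rightarrow> real" where
  "hardy_dist F V = (INF v\<in>V. hardy_norm (\<lambda>z. F z - v z))"

text \<open>
  The supremum is taken in the extended reals, where a positive number divided by \<open>0\<close> is \<open>\<infinity>\<close>;
  so a nonzero \<open>F \<in> K\<close> at distance \<open>0\<close> from \<open>V\<close> makes \<open>hardy_mu K V\<close> infinite.
\<close>

definition hardy_mu :: "(complex \<Rightarrow> complex) set \<Rightarrow> (complex \<Rightarrow> complex) set \<Rightarrow> ereal" where
  "hardy_mu K V =
     (SUP F\<in>{F \<in> K. \<exists>z\<in>ball 0 1. F z \<noteq> 0}. ereal (hardy_norm F) / ereal (hardy_dist F V))"

text \<open>Vectors in \<open>\<complex>\<^sup>m\<close> are functions on \<open>nat\<close> that vanish outside \<open>{1..m}\<close>.\<close>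

definition point_eval :: "nat \<Rightarrow> (nat \<Rightarrow> complex) \<Rightarrow> (complex \<Rightarrow> complex) \<Rightarrow> (nat \<Rightarrow> complex)" where
  "point_eval m \<zeta> F = (\<lambda>k. if k \<in> {1..m} then F (\<zeta> k) else 0)"

definition hardy_ker :: "((complex \<Rightarrow> complex) \<Rightarrow> (nat \<Rightarrow> complex)) \<Rightarrow> (complex \<Rightarrow> complex) set" where
  "hardy_ker L = {F \<in> hardy2. L F = (\<lambda>k. 0)}"

text \<open>For \<open>n \<ge> 1\<close>, the polynomial functions of degree at most \<open>n - 1\<close>.\<close>

definition poly_space :: "nat \<Rightarrow> (complex \<Rightarrow> complex) set" where
  "poly_space n = {poly p |p. degree p \<le> n - 1}"

end

theory Submission
  imports Defs
begin

text \<open>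
  Everything happens on Taylor coefficients. Write \<open>f i\<close> for the coefficients of \<open>F\<close> and
  \<open>c = r ^ (2 * m)\<close>. The norm is the \<open>\<ell>\<^sup>2\<close> norm of \<open>f\<close>, and the distance to the polynomials of
  degree below \<open>n\<close> is the \<open>\<ell>\<^sup>2\<close> norm of the tail that starts at \<open>n\<close>
  (\<open>hardy_dist_poly_space\<close>). So the claim is that, if \<open>F\<close> vanishes at the sample points, the tail
  controls the first \<open>n\<close> coefficients with a sharp constant.

  At \<open>m\<close> equispaced points on a circle, two powers with exponents congruent modulo \<open>m\<close> take
  proportional values (aliasing), and a discrete Fourier transform of the \<open>m\<close> sampled values
  separates the residue classes (\<open>residue_class_sums_0\<close>). Vanishing at all the points thus means
  that, for each \<open>j < m\<close>, the sum of \<open>f i * r ^ i\<close> over \<open>i \<equiv> j\<close> modulo \<open>m\<close> is zero. Solving for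
  its first term and applying the Cauchy--Schwarz inequality to the others bounds
  \<open>\<bar>f j\<bar>\<^sup>2\<close> by \<open>c / (1 - c)\<close> times the sum of \<open>\<bar>f i\<bar>\<^sup>2\<close> over the remaining members of the
  class (\<open>low_coeff_le_residue_class\<close>); the factor comes from a geometric series. The classes of
  the indices below \<open>n\<close> are disjoint, and since \<open>n \<le> m\<close> their remaining members all lie in the
  tail. Hence the squared norm is at most \<open>c / (1 - c) + 1 = 1 / (1 - c)\<close> times the squared
  distance (\<open>hardy_norm_le_dist\<close>).

  Equality in Cauchy--Schwarz for the class of \<open>0\<close> alone dictates a function for which the bound
  is attained (\<open>extremal_function\<close>); the supremum is a maximum, whatever \<open>n\<close> is.
\<close>

section \<open>Hardy functions and their Taylor coefficients\<close>

lemma hardy_coeff_sums: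
  assumes "F holomorphic_on ball 0 1" "z \<in> ball 0 1"
  shows "(\<lambda>i. hardy_coeff F i * z ^ i) sums F z"
  using holomorphic_power_series[OF assms] by (simp add: hardy_coeff_def fps_expansion_def)

lemma hardy_coeff_unique:
  assumes "\<And>z. z \<in> ball 0 1 \<Longrightarrow> (\<lambda>i. a i * z ^ i) sums F z"
  shows "hardy_coeff F = a"
proof -
  have "ereal (norm (1/2 :: complex)) \<le> conv_radius a"
    by (rule conv_radius_geI, rule sums_summable, rule assms) simp
  then have "conv_radius a > 0"
    by (rule order.strict_trans2[rotated]) simp
  moreover have "eventually (\<lambda>z. z \<in> ball 0 1) (nhds (0::complex))"
    by (intro eventually_nhds_in_open) auto
  then have "eventually (\<lambda>z. eval_fps (Abs_fps a) z = F z) (nhds 0)"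
    by eventually_elim (use assms in \<open>simp add: eval_fps_def sums_iff\<close>)
  ultimately have "F has_fps_expansion Abs_fps a"
    by (simp add: has_fps_expansion_def fps_conv_radius_def)
  then show ?thesis
    by (simp add: hardy_coeff_def fps_expansion_eqI fun_eq_iff)
qed

lemma hardy_coeff_diff:
  assumes "F holomorphic_on ball 0 1" "G holomorphic_on ball 0 1"
  shows "hardy_coeff (\<lambda>z. F z - G z) i = hardy_coeff F i - hardy_coeff G i"
proof -
  have "hardy_coeff (\<lambda>z. F z - G z) = (\<lambda>i. hardy_coeff F i - hardy_coeff G i)"
    by (rule hardy_coeff_unique)
      (use hardy_coeff_sums[OF assms(1)] hardy_coeff_sums[OF assms(2)]
       in \<open>auto simp: left_diff_distrib intro!: sums_diff\<close>)
  then show ?thesis by simp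
qed

lemma hardy_coeff_poly: "hardy_coeff (poly p) = coeff p"
proof (rule hardy_coeff_unique)
  fix z :: complex
  have "(\<lambda>i. coeff p i * z ^ i) sums (\<Sum>i\<le>degree p. coeff p i * z ^ i)"
    by (rule sums_finite) (auto simp: coeff_eq_0)
  then show "(\<lambda>i. coeff p i * z ^ i) sums poly p z"
    by (simp add: poly_altdef)
qed

lemma hardy_norm_pos:
  assumes "F \<in> hardy2" "z \<in> ball 0 1" "F z \<noteq> 0"
  shows "hardy_norm F > 0"
proof -
  have F: "F holomorphic_on ball 0 1" "summable (\<lambda>i. (cmod (hardy_coeff F i))\<^sup>2)"
    using assms(1) by (auto simp: hardy2_def)
  have "\<exists>i. hardy_coeff F i \<noteq> 0"
  proof (rule ccontr)
    assume "\<not> ?thesis"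
    then have "(\<lambda>i. 0) sums F z"
      using hardy_coeff_sums[OF F(1) assms(2)] by simp
    then show False using assms(3) by (simp add: sums_iff)
  qed
  then obtain i where "hardy_coeff F i \<noteq> 0" by blast
  then show ?thesis
    unfolding hardy_norm_def
    by (intro real_sqrt_gt_zero suminf_pos2[OF F(2), of i]) auto
qed

lemma summable_restrict:
  fixes a :: "nat \<Rightarrow> real"
  assumes "summable a" "\<And>i. a i \<ge> 0"
  shows "summable (\<lambda>i. if P i then a i else 0)"
  by (rule summable_comparison_test'[OF assms(1)]) (use assms(2) in auto)

text \<open>Parseval turns the distance to the polynomials of degree below \<open>n\<close> into a tail sum:
  subtracting a polynomial changes only the first \<open>n\<close> coefficients, and the best choice
  cancels all of them.\<close>

lemma hardy_dist_poly_space: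
  assumes F: "F \<in> hardy2" and n: "n \<ge> 1"
  shows "hardy_dist F (poly_space n) = sqrt (\<Sum>i. if n \<le> i then (cmod (hardy_coeff F i))\<^sup>2 else 0)"
    (is "_ = sqrt (suminf ?t)")
proof -
  have hol: "F holomorphic_on ball 0 1" and sm: "summable (\<lambda>i. (cmod (hardy_coeff F i))\<^sup>2)"
    using F by (auto simp: hardy2_def)
  have tail: "summable ?t"
    by (rule summable_restrict[OF sm]) simp
  have coeff: "hardy_coeff (\<lambda>z. F z - poly p z) i = hardy_coeff F i - coeff p i" for p i
    by (subst hardy_coeff_diff[OF hol]) (auto simp: hardy_coeff_poly intro!: holomorphic_intros)
  have high: "coeff p i = 0" if "degree p \<le> n - 1" "n \<le> i" for p :: "complex poly" and i
    using that n by (intro coeff_eq_0) linarith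
  \<comment> \<open>The norm is the square root of a \<open>suminf\<close>, which means something only for a summable
    series, so that is established for every competitor first.\<close>
  have lower: "sqrt (suminf ?t) \<le> hardy_norm (\<lambda>z. F z - v z)" if v: "v \<in> poly_space n" for v
  proof -
    obtain p where p: "v = poly p" "degree p \<le> n - 1"
      using v by (auto simp: poly_space_def)
    have "(\<lambda>i. (cmod (hardy_coeff F i - coeff p i))\<^sup>2) =
        (\<lambda>i. ?t i + (if i \<in> {..<n} then (cmod (hardy_coeff F i - coeff p i))\<^sup>2 else 0))"
      by (auto simp: fun_eq_iff high[OF p(2)])
    then have "summable (\<lambda>i. (cmod (hardy_coeff F i - coeff p i))\<^sup>2)"
      by (simp only:) (intro summable_add tail summable_If_finite_set finite_lessThan)
    then have "suminf ?t \<le> (\<Sum>i. (cmod (hardy_coeff F i - coeff p i))\<^sup>2)"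
      by (intro suminf_le tail) (auto simp: high[OF p(2)])
    then show ?thesis
      by (simp add: hardy_norm_def coeff p(1))
  qed
  define q where "q = (\<Sum>i<n. monom (hardy_coeff F i) i)"
  have cq: "coeff q i = (if i < n then hardy_coeff F i else 0)" for i
    by (simp add: q_def coeff_sum)
  have "degree q \<le> n - 1"
    by (rule degree_le) (auto simp: cq)
  then have q: "poly q \<in> poly_space n"
    by (auto simp: poly_space_def)
  have "(\<lambda>i. (cmod (hardy_coeff F i - coeff q i))\<^sup>2) = ?t"
    by (auto simp: cq)
  then have best: "hardy_norm (\<lambda>z. F z - poly q z) = sqrt (suminf ?t)"
    by (simp add: hardy_norm_def coeff)
  have "bdd_below ((\<lambda>v. hardy_norm (\<lambda>z. F z - v z)) ` poly_space n)"
    using lower by (rule bdd_belowI2)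
  then have "hardy_dist F (poly_space n) \<le> sqrt (suminf ?t)"
    unfolding hardy_dist_def best[symmetric] by (rule cINF_lower) (rule q)
  moreover have "sqrt (suminf ?t) \<le> hardy_dist F (poly_space n)"
    unfolding hardy_dist_def using q lower by (intro cINF_greatest) auto
  ultimately show ?thesis
    by (rule antisym)
qed

section \<open>Series over a residue class\<close>

text \<open>The index \<open>j\<close> itself is left out by \<open>m \<le> i\<close>, since this series weighs the members of the
  class against its smallest one. It occurs below with \<open>q = r\<^sup>2\<close>, for the Cauchy--Schwarz bound,
  and with \<open>q = r * z\<close>, for the extremal function.\<close>

lemma geometric_residue_class_sums:
  fixes q :: "'a :: {real_normed_field, banach}"
  assumes "norm q < 1" "j < m"
  shows "(\<lambda>i. if i mod m = j \<and> m \<le> i then q ^ i else 0) sums (q ^ (j + m) / (1 - q ^ m))"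
    (is "?f sums _")
proof -
  let ?g = "\<lambda>s. j + m + s * m"
  have "norm (q ^ m) < 1"
    using assms by (simp add: norm_power power_less_one_iff)
  then have "(\<lambda>s. q ^ (j + m) * (q ^ m) ^ s) sums (q ^ (j + m) * (1 / (1 - q ^ m)))"
    by (intro sums_mult geometric_sums)
  also have "(\<lambda>s. q ^ (j + m) * (q ^ m) ^ s) = (\<lambda>s. ?f (?g s))"
    using assms(2) by (auto simp: power_add power_mult[symmetric] mult.commute)
  finally have "(\<lambda>s. ?f (?g s)) sums (q ^ (j + m) / (1 - q ^ m))" by simp
  moreover have "?f i = 0" if "i \<notin> range ?g" for i
  proof (rule ccontr)
    assume "?f i \<noteq> 0"
    then have i: "i mod m = j" "m \<le> i" by (auto split: if_splits)
    have "i div m \<ge> 1" using i assms(2) by (simp add: div_greater_zero_iff Suc_le_eq)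
    then have "i = ?g (i div m - 1)"
      using div_mult_mod_eq[of i m] i(1) by (cases "i div m") auto
    then show False using that by blast
  qed
  moreover have "strict_mono ?g"
    using assms(2) by (intro strict_monoI) simp
  ultimately show ?thesis
    using sums_mono_reindex[of ?g ?f] by blast
qed

text \<open>Stated with \<open>sums\<close> for the products themselves and not for their norms, the inequality
  applies directly to a series that is only known to converge to \<open>s\<close>; it is the limit of the
  inequality for finite sums.\<close>

lemma Cauchy_Schwarz_sums:
  fixes u v :: "nat \<Rightarrow> 'a :: real_normed_field"
  assumes "(\<lambda>i. u i * v i) sums s"
    and u: "summable (\<lambda>i. (norm (u i))\<^sup>2)" and v: "summable (\<lambda>i. (norm (v i))\<^sup>2)"
  shows "(norm s)\<^sup>2 \<le> (\<Sum>i. (norm (u i))\<^sup>2) * (\<Sum>i. (norm (v i))\<^sup>2)"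
proof -
  have "(\<lambda>N. (norm (\<Sum>i<N. u i * v i))\<^sup>2) \<longlonglongrightarrow> (norm s)\<^sup>2"
    using assms(1) unfolding sums_def by (intro tendsto_intros)
  moreover have "(norm (\<Sum>i<N. u i * v i))\<^sup>2 \<le> (\<Sum>i. (norm (u i))\<^sup>2) * (\<Sum>i. (norm (v i))\<^sup>2)" for N
  proof -
    have "(norm (\<Sum>i<N. u i * v i))\<^sup>2 \<le> (\<Sum>i<N. norm (u i) * norm (v i))\<^sup>2"
      by (intro power_mono) (auto simp: norm_mult[symmetric] norm_sum)
    also have "\<dots> \<le> (\<Sum>i<N. (norm (u i))\<^sup>2) * (\<Sum>i<N. (norm (v i))\<^sup>2)"
      by (rule Cauchy_Schwarz_ineq_sum)
    also have "\<dots> \<le> (\<Sum>i. (norm (u i))\<^sup>2) * (\<Sum>i. (norm (v i))\<^sup>2)"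
      by (intro mult_mono sum_le_suminf u v suminf_nonneg sum_nonneg) auto
    finally show ?thesis .
  qed
  ultimately show ?thesis
    by (intro LIMSEQ_le_const2) auto
qed

section \<open>Aliasing on the circle of sample points\<close>

lemma sum_powers_root_of_unity:
  fixes m p :: nat
  assumes "m \<ge> 1"
  defines "\<omega> \<equiv> cis (2 * pi / real m)"
  shows "(\<Sum>k<m. (\<omega> ^ p) ^ k) = (if m dvd p then of_nat m else 0)"
proof -
  have \<omega>: "\<omega> ^ p = 1 \<longleftrightarrow> m dvd p"
  proof -
    have "\<omega> ^ p = exp (2 * of_real pi * \<i> * of_nat p / of_nat m)"
      unfolding \<omega>_def Complex.DeMoivre unfolding cis_conv_exp by (simp add: mult_ac)
    then show ?thesis using complex_root_unity_eq_1[of m p] assms(1) by simp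
  qed
  have "(\<omega> ^ p) ^ m = (\<omega> ^ m) ^ p"
    by (simp add: power_mult[symmetric] mult.commute)
  also have "\<omega> ^ m = 1"
    using assms(1) by (simp add: \<omega>_def Complex.DeMoivre)
  finally have "(\<omega> ^ p) ^ m = 1" by simp
  then show ?thesis
    using \<omega> geometric_sum[of "\<omega> ^ p" m] by auto
qed

text \<open>A discrete Fourier transform of the values at the \<open>m\<close> equispaced points separates the
  residue classes modulo \<open>m\<close> of the coefficients. If all values vanish, then so does the part
  of the series at \<open>r\<close> that belongs to any one class.\<close>

lemma residue_class_sums_0:
  fixes r :: real and m j :: nat
  assumes "j < m"
    and vanish: "\<And>k. k < m \<Longrightarrow> (\<lambda>i. f i * (of_real r * cis (2 * pi / real m) ^ k) ^ i) sums 0"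
  shows "(\<lambda>i. if i mod m = j then f i * of_real r ^ i else 0) sums 0"
proof -
  define \<omega> where "\<omega> = cis (2 * pi / real m)"
  \<comment> \<open>The transform needs the weights \<open>\<omega> powi (- j * k)\<close>; as \<open>\<omega> ^ m = 1\<close>, the exponent
    \<open>m - j\<close> serves instead of \<open>- j\<close>.\<close>
  have "(\<lambda>i. \<Sum>k<m. \<omega> ^ ((m - j) * k) * (f i * (of_real r * \<omega> ^ k) ^ i)) sums
      (\<Sum>k<m. \<omega> ^ ((m - j) * k) * 0)"
    unfolding \<omega>_def by (intro sums_sum sums_mult vanish) simp
  also have "(\<lambda>i. \<Sum>k<m. \<omega> ^ ((m - j) * k) * (f i * (of_real r * \<omega> ^ k) ^ i)) =
      (\<lambda>i. of_nat m * (if i mod m = j then f i * of_real r ^ i else 0))"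
  proof
    fix i
    have "(\<Sum>k<m. \<omega> ^ ((m - j) * k) * (f i * (of_real r * \<omega> ^ k) ^ i)) =
        f i * of_real r ^ i * (\<Sum>k<m. (\<omega> ^ (i + (m - j))) ^ k)"
      by (simp add: sum_distrib_left power_mult_distrib power_mult[symmetric] power_add
          algebra_simps)
    also have "(\<Sum>k<m. (\<omega> ^ (i + (m - j))) ^ k) = (if m dvd i + (m - j) then of_nat m else 0)"
      unfolding \<omega>_def using assms(1) by (intro sum_powers_root_of_unity) simp
    also have "m dvd i + (m - j) \<longleftrightarrow> i mod m = j"
    proof -
      have "m dvd i + (m - j) \<longleftrightarrow> int m dvd int i - int j + int m"
        using assms(1) by (simp flip: int_dvd_int_iff add: of_nat_diff algebra_simps)
      also have "\<dots> \<longleftrightarrow> int i mod int m = int j mod int m"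
        by (simp add: mod_eq_dvd_iff)
      also have "\<dots> \<longleftrightarrow> i mod m = j"
        using assms(1) by (simp flip: of_nat_mod)
      finally show ?thesis .
    qed
    finally show "(\<Sum>k<m. \<omega> ^ ((m - j) * k) * (f i * (of_real r * \<omega> ^ k) ^ i)) =
        of_nat m * (if i mod m = j then f i * of_real r ^ i else 0)"
      by simp
  qed
  finally show ?thesis
    using sums_mult_iff[of "of_nat m :: complex" _ 0] assms(1) by simp
qed

text \<open>The coefficient \<open>f j\<close> is, up to the factor \<open>- (r ^ j)\<close>, the sum of the other terms of its
  class. In the Cauchy--Schwarz bound for that sum the weights contribute
  \<open>r ^ (2 * (j + m)) / (1 - r ^ (2 * m))\<close>, and \<open>r ^ (2 * j)\<close> cancels: the constant is the same for
  every class.\<close>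

lemma low_coeff_le_residue_class:
  fixes r :: real and f :: "nat \<Rightarrow> complex"
  assumes r: "0 < r" "r < 1" and "j < m"
    and sm: "summable (\<lambda>i. (cmod (f i))\<^sup>2)"
    and class0: "(\<lambda>i. if i mod m = j then f i * of_real r ^ i else 0) sums 0"
  shows "(cmod (f j))\<^sup>2 \<le> r ^ (2 * m) / (1 - r ^ (2 * m)) *
    (\<Sum>i. if i mod m = j \<and> m \<le> i then (cmod (f i))\<^sup>2 else 0)"
proof -
  let ?C = "\<lambda>i. i mod m = j \<and> m \<le> i"
  let ?u = "\<lambda>i. if ?C i then f i else 0" and ?v = "\<lambda>i. if ?C i then complex_of_real r ^ i else 0"
  have "(\<lambda>i. (if i mod m = j then f i * of_real r ^ i else 0) -
      (if i = j then f i * of_real r ^ i else 0)) sums (0 - f j * of_real r ^ j)"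
    by (intro sums_diff class0 sums_single)
  also have "(\<lambda>i. (if i mod m = j then f i * of_real r ^ i else 0) -
      (if i = j then f i * of_real r ^ i else 0)) = (\<lambda>i. ?u i * ?v i)"
    using assms(3) by (auto simp: fun_eq_iff)
  finally have *: "(\<lambda>i. ?u i * ?v i) sums (- (f j * of_real r ^ j))" by simp
  have u2: "(\<lambda>i. (norm (?u i))\<^sup>2) = (\<lambda>i. if ?C i then (cmod (f i))\<^sup>2 else 0)" by auto
  have v2: "(\<lambda>i. (norm (?v i))\<^sup>2) = (\<lambda>i. if ?C i then (r\<^sup>2) ^ i else 0)"
    by (rule ext) (simp add: norm_power power2_eq_square flip: power_mult_distrib)
  have geo: "(\<lambda>i. if ?C i then (r\<^sup>2) ^ i else 0) sums ((r\<^sup>2) ^ (j + m) / (1 - (r\<^sup>2) ^ m))"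
    using r assms(3) by (intro geometric_residue_class_sums) (auto simp: abs_square_less_1)
  define S where "S = (\<Sum>i. if ?C i then (cmod (f i))\<^sup>2 else 0)"
  have "(norm (- (f j * of_real r ^ j)))\<^sup>2 \<le> S * ((r\<^sup>2) ^ (j + m) / (1 - (r\<^sup>2) ^ m))"
    using Cauchy_Schwarz_sums[OF *] geo summable_restrict[OF sm, of ?C]
    unfolding u2 v2 S_def by (simp add: sums_iff)
  then have "r ^ (2 * j) * (cmod (f j))\<^sup>2 \<le> r ^ (2 * j) * (r ^ (2 * m) / (1 - r ^ (2 * m)) * S)"
    using r by (simp add: norm_mult norm_power power_mult_distrib power_mult[symmetric] power_add
        algebra_simps)
  then show ?thesis
    using r unfolding S_def by (subst (asm) mult_le_cancel_left_pos) auto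
qed

section \<open>The sharp bound\<close>

lemma hardy_norm_le_dist:
  fixes r :: real and m n :: nat
  assumes r: "0 < r" "r < 1" and "1 \<le> n" "n \<le> m" and F: "F \<in> hardy2"
    and vanish: "\<And>k. k < m \<Longrightarrow> F (of_real r * cis (2 * pi / real m) ^ k) = 0"
  shows "hardy_norm F \<le> 1 / sqrt (1 - r ^ (2 * m)) * hardy_dist F (poly_space n)"
proof -
  define f where "f = hardy_coeff F"
  define c where "c = r ^ (2 * m)"
  have c: "0 < c" "c < 1"
    using r assms(3,4) by (auto simp: c_def power_less_one_iff)
  have hol: "F holomorphic_on ball 0 1" and sm: "summable (\<lambda>i. (cmod (f i))\<^sup>2)"
    using F by (auto simp: hardy2_def f_def)
  have "(\<lambda>i. f i * (of_real r * cis (2 * pi / real m) ^ k) ^ i) sums 0" if "k < m" for k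
    using hardy_coeff_sums[OF hol, of "of_real r * cis (2 * pi / real m) ^ k"] vanish[OF that] r
    by (simp add: f_def norm_mult norm_power)
  note class0 = residue_class_sums_0[OF _ this]
  define T where "T = (\<Sum>i. if n \<le> i then (cmod (f i))\<^sup>2 else 0)"
  have smr: "summable (\<lambda>i. if P i then (cmod (f i))\<^sup>2 else 0)" for P
    by (rule summable_restrict[OF sm]) simp
  have "(\<Sum>j<n. (cmod (f j))\<^sup>2) \<le>
      (\<Sum>j<n. c / (1 - c) * (\<Sum>i. if i mod m = j \<and> m \<le> i then (cmod (f i))\<^sup>2 else 0))"
    unfolding c_def using assms(4) by (intro sum_mono low_coeff_le_residue_class r sm class0) auto
  also have "\<dots> = c / (1 - c) * (\<Sum>i. \<Sum>j<n. if i mod m = j \<and> m \<le> i then (cmod (f i))\<^sup>2 else 0)"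
    by (simp add: sum_distrib_left suminf_sum[OF smr])
  also have "\<dots> \<le> c / (1 - c) * T"
    \<comment> \<open>The classes are disjoint and, as \<open>n \<le> m\<close>, lie in the tail that starts at \<open>n\<close>.\<close>
    unfolding T_def
  proof (intro mult_left_mono suminf_le summable_sum smr)
    fix i
    have "(\<Sum>j<n. if i mod m = j \<and> m \<le> i then (cmod (f i))\<^sup>2 else 0) =
        (\<Sum>j<n. if i mod m = j then (if m \<le> i then (cmod (f i))\<^sup>2 else 0) else 0)"
      by (intro sum.cong) auto
    also have "\<dots> \<le> (if n \<le> i then (cmod (f i))\<^sup>2 else 0)"
      using assms(4) by simp
    finally show "(\<Sum>j<n. if i mod m = j \<and> m \<le> i then (cmod (f i))\<^sup>2 else 0) \<le>
        (if n \<le> i then (cmod (f i))\<^sup>2 else 0)" .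
  qed (use c in auto)
  finally have low: "(\<Sum>j<n. (cmod (f j))\<^sup>2) \<le> c / (1 - c) * T" .
  have "(\<Sum>i. (cmod (f i))\<^sup>2) =
      (\<Sum>i. (if i \<in> {..<n} then (cmod (f i))\<^sup>2 else 0) + (if n \<le> i then (cmod (f i))\<^sup>2 else 0))"
    by (intro suminf_cong) auto
  also have "\<dots> = (\<Sum>j<n. (cmod (f j))\<^sup>2) + T"
    unfolding T_def
    by (rule sums_unique[symmetric], intro sums_add sums_If_finite_set summable_sums smr) simp
  also have "\<dots> \<le> c / (1 - c) * T + T"
    using low by simp
  also have "\<dots> = T / (1 - c)"
    using c by (simp add: field_simps)
  finally have "sqrt (\<Sum>i. (cmod (f i))\<^sup>2) \<le> sqrt (T / (1 - c))"
    by simp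
  then show ?thesis
    unfolding hardy_dist_poly_space[OF F assms(3)]
    by (simp only: hardy_norm_def f_def T_def c_def real_sqrt_divide real_sqrt_one) simp
qed

text \<open>Cauchy--Schwarz is an equality when the coefficients are proportional to the weights. The
  choice \<open>f i = r ^ i\<close> for the positive multiples \<open>i\<close> of \<open>m\<close> forces \<open>f 0 = - c / (1 - c)\<close>, and all
  other coefficients are zero. The resulting \<open>F\<close> is a function of \<open>(r * z) ^ m\<close>, which equals
  \<open>c\<close> at every sample point. Its only coefficient below \<open>m\<close> is \<open>f 0\<close>, so the same function
  serves for every \<open>n\<close> from \<open>1\<close> to \<open>m\<close>.\<close>

lemma extremal_function:
  fixes r :: real and m n :: nat
  assumes r: "0 < r" "r < 1" and "1 \<le> n" "n \<le> m"
  obtains F where "F \<in> hardy2" "F 0 \<noteq> 0" "\<And>z. z ^ m = of_real r ^ m \<Longrightarrow> F z = 0"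
    and "hardy_dist F (poly_space n) > 0"
    and "hardy_norm F = 1 / sqrt (1 - r ^ (2 * m)) * hardy_dist F (poly_space n)"
proof -
  define c where "c = r ^ (2 * m)"
  define F :: "complex \<Rightarrow> complex" where
    "F = (\<lambda>z. (of_real r * z) ^ m / (1 - (of_real r * z) ^ m) - of_real (c / (1 - c)))"
  have m: "m \<ge> 1" using assms by simp
  have c: "0 < c" "c < 1" "c = (r\<^sup>2) ^ m"
    using r m by (auto simp: c_def power_less_one_iff simp flip: power_mult)
  let ?C = "\<lambda>i. i mod m = 0 \<and> m \<le> i"
  define a :: "nat \<Rightarrow> complex" where
    "a i = (if ?C i then of_real r ^ i else 0) - (if i = 0 then of_real (c / (1 - c)) else 0)" for i
  have a_sums: "(\<lambda>i. a i * z ^ i) sums F z" if "z \<in> ball 0 1" for z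
  proof -
    have "cmod (of_real r * z) < 1"
      using r that mult_strict_mono[of r 1 "cmod z" 1] by (simp add: norm_mult)
    then have "(\<lambda>i. (if ?C i then (of_real r * z) ^ i else 0) - (if i = 0 then of_real (c / (1 - c)) else 0))
        sums F z"
      unfolding F_def
      using m geometric_residue_class_sums[of "of_real r * z" 0 m]
      by (intro sums_diff sums_single) auto
    also have "(\<lambda>i. (if ?C i then (of_real r * z) ^ i else 0) - (if i = 0 then of_real (c / (1 - c)) else 0)) =
        (\<lambda>i. a i * z ^ i)"
      using m by (auto simp: a_def fun_eq_iff power_mult_distrib)
    finally show ?thesis .
  qed
  have coeff: "hardy_coeff F = a"
    by (rule hardy_coeff_unique) (rule a_sums)
  have hol: "F holomorphic_on ball 0 1"
    using a_sums by (intro power_series_holomorphic[of 0 1 a]) simp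
  have geo: "(\<lambda>i. if ?C i then (r\<^sup>2) ^ i else 0) sums (c / (1 - c))"
    using r m geometric_residue_class_sums[of "r\<^sup>2" 0 m] by (auto simp: abs_square_less_1 c(3))
  have a2: "(cmod (a i))\<^sup>2 = (if ?C i then (r\<^sup>2) ^ i else 0) + (if i = 0 then (c / (1 - c))\<^sup>2 else 0)" for i
    using m r c by (auto simp: a_def norm_power power_mult[symmetric] mult.commute norm_divide
        simp flip: of_real_divide)
  have norm2: "(\<lambda>i. (cmod (a i))\<^sup>2) sums (c / (1 - c) + (c / (1 - c))\<^sup>2)"
    unfolding a2 by (intro sums_add geo sums_single)
  have F: "F \<in> hardy2"
    using hol norm2 by (auto simp: hardy2_def coeff sums_iff)
  have F0: "F 0 \<noteq> 0"
  proof -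
    have "F 0 = - of_real (c / (1 - c))"
      using m by (simp add: F_def power_0_left)
    moreover have "c / (1 - c) \<noteq> 0"
      using c(1,2) by simp
    ultimately show ?thesis
      by (simp only: neg_equal_0_iff_equal of_real_eq_0_iff) simp
  qed
  have vanish: "F z = 0" if "z ^ m = of_real r ^ m" for z
    by (simp add: F_def c_def power_mult_distrib that power_add[symmetric] flip: mult_2)
  have "(\<lambda>i. if n \<le> i then (cmod (a i))\<^sup>2 else 0) = (\<lambda>i. if ?C i then (r\<^sup>2) ^ i else 0)"
    using assms(3,4) by (auto simp: a2)
  then have dist: "hardy_dist F (poly_space n) = sqrt (c / (1 - c))"
    using geo unfolding hardy_dist_poly_space[OF F assms(3)] coeff by (simp add: sums_iff)
  then have pos: "hardy_dist F (poly_space n) > 0"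
    using c by simp
  have "c / (1 - c) + (c / (1 - c))\<^sup>2 = 1 / (1 - c) * (c / (1 - c))"
    using c(1,2) by (simp add: divide_simps power2_eq_square) (simp add: algebra_simps)
  then have "hardy_norm F = sqrt (1 / (1 - c) * (c / (1 - c)))"
    using norm2 by (simp add: hardy_norm_def coeff sums_iff)
  then have "hardy_norm F = 1 / sqrt (1 - r ^ (2 * m)) * hardy_dist F (poly_space n)"
    unfolding dist c_def[symmetric] by (simp only: real_sqrt_mult real_sqrt_divide real_sqrt_one)
  with F F0 vanish pos show ?thesis by (rule that)
qed

theorem proposition2:
  fixes r :: real and m n :: nat and \<zeta> :: "nat \<Rightarrow> complex"
  assumes "0 < r" and "r < 1" and "m \<ge> 1"
    and "\<And>k. k \<in> {1..m} \<Longrightarrow>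
           \<zeta> k = complex_of_real r * exp (\<i> * complex_of_real (2 * pi / real m * (real k - 1)))"
    and "1 \<le> n" and "n \<le> m"
  shows "hardy_mu (hardy_ker (point_eval m \<zeta>)) (poly_space n) = ereal (1 / sqrt (1 - r ^ (2 * m)))"
proof -
  have \<zeta>: "\<zeta> (Suc k) = of_real r * cis (2 * pi / real m) ^ k" if "k < m" for k
  proof -
    have "\<zeta> (Suc k) = of_real r * exp (\<i> * of_real (real k * (2 * pi / real m)))"
      using assms(4)[of "Suc k"] that by (simp add: mult_ac)
    then show ?thesis
      unfolding Complex.DeMoivre unfolding cis_conv_exp .
  qed
  have ker: "F \<in> hardy_ker (point_eval m \<zeta>) \<longleftrightarrow>
      F \<in> hardy2 \<and> (\<forall>k<m. F (of_real r * cis (2 * pi / real m) ^ k) = 0)" for F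
  proof -
    have "(point_eval m \<zeta> F = (\<lambda>k. 0)) \<longleftrightarrow> (\<forall>k\<in>{1..m}. F (\<zeta> k) = 0)"
      by (auto simp: point_eval_def fun_eq_iff)
    also have "{1..m} = Suc ` {..<m}"
      by (simp add: image_Suc_lessThan)
    finally show ?thesis by (auto simp: hardy_ker_def \<zeta>)
  qed
  show ?thesis
    unfolding hardy_mu_def
  proof (rule antisym)
    show "(SUP F\<in>{F \<in> hardy_ker (point_eval m \<zeta>). \<exists>z\<in>ball 0 1. F z \<noteq> 0}.
        ereal (hardy_norm F) / ereal (hardy_dist F (poly_space n))) \<le> ereal (1 / sqrt (1 - r ^ (2 * m)))"
    proof (rule SUP_least)
      fix F assume "F \<in> {F \<in> hardy_ker (point_eval m \<zeta>). \<exists>z\<in>ball 0 1. F z \<noteq> 0}"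
      then obtain z where F: "F \<in> hardy2" "\<And>k. k < m \<Longrightarrow> F (of_real r * cis (2 * pi / real m) ^ k) = 0"
        and z: "z \<in> ball 0 1" "F z \<noteq> 0"
        by (auto simp: ker)
      have le: "hardy_norm F \<le> 1 / sqrt (1 - r ^ (2 * m)) * hardy_dist F (poly_space n)"
        by (rule hardy_norm_le_dist) (use assms F in auto)
      \<comment> \<open>The inequality bounds the quotient only for a positive distance; it also forces the
        distance to be positive, because \<open>F\<close> has a positive norm.\<close>
      have "0 < 1 / sqrt (1 - r ^ (2 * m)) * hardy_dist F (poly_space n)"
        using le hardy_norm_pos[OF F(1) z] by linarith
      moreover have "1 / sqrt (1 - r ^ (2 * m)) > 0"
        using assms by (simp add: power_less_one_iff)
      ultimately have "hardy_dist F (poly_space n) > 0"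
        by (simp only: zero_less_mult_iff) auto
      then show "ereal (hardy_norm F) / ereal (hardy_dist F (poly_space n))
          \<le> ereal (1 / sqrt (1 - r ^ (2 * m)))"
        using le by (simp add: field_simps)
    qed
  next
    obtain F where E: "F \<in> hardy2" "F 0 \<noteq> 0" "\<And>z. z ^ m = of_real r ^ m \<Longrightarrow> F z = 0"
      "hardy_dist F (poly_space n) > 0"
      "hardy_norm F = 1 / sqrt (1 - r ^ (2 * m)) * hardy_dist F (poly_space n)"
      using extremal_function[OF assms(1,2,5,6)] by metis
    have "(of_real r * cis (2 * pi / real m) ^ k) ^ m = complex_of_real r ^ m" for k
    proof -
      have "(cis (2 * pi / real m) ^ k) ^ m = (cis (2 * pi / real m) ^ m) ^ k"
        by (simp add: power_mult[symmetric] mult.commute)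
      also have "\<dots> = 1"
        using assms(3) by (simp add: Complex.DeMoivre)
      finally show ?thesis by (simp add: power_mult_distrib)
    qed
    then have "F \<in> {F \<in> hardy_ker (point_eval m \<zeta>). \<exists>z\<in>ball 0 1. F z \<noteq> 0}"
      using E(1-3) by (auto simp: ker intro!: bexI[of _ 0])
    moreover have "ereal (1 / sqrt (1 - r ^ (2 * m))) =
        ereal (hardy_norm F) / ereal (hardy_dist F (poly_space n))"
      using E(4,5) by simp
    ultimately show "ereal (1 / sqrt (1 - r ^ (2 * m))) \<le>
        (SUP F\<in>{F \<in> hardy_ker (point_eval m \<zeta>). \<exists>z\<in>ball 0 1. F z \<noteq> 0}.
          ereal (hardy_norm F) / ereal (hardy_dist F (poly_space n)))"
      by (intro SUP_upper2[of F]) auto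
  qed
qed

end
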